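(* Let $\mathcal{A}\in\mathbb{C}^{I_1\times\cdots\times I_M\times J_1\times\cdots\times J_N}$ and $\mathcal{B}\in\mathbb{C}^{J_1\times\cdots\times J_N\times K_1\times\cdots\times K_L}$. Let $\mathcal{M}\in\mathbb{C}^{I_1\times\cdots\times I_M\times I_1\times\cdots\times I_M}$, $\mathcal{N}\in\mathbb{C}^{J_1\times\cdots\times J_N\times J_1\times\cdots\times J_N}$ and $\mathcal{L}\in\mathbb{C}^{K_1\times\cdots\times K_L\times K_1\times\cdots\times K_L}$ be Hermitian positive definite tensors. Then $(\mathcal{A}*_N\mathcal{B})^{\dagger}_{\mathcal{M}\mathcal{L}}=\mathcal{B}^{\dagger}_{\mathcal{N}\mathcal{L}}*_N\mathcal{A}^{\dagger}_{\mathcal{M}\mathcal{N}}$ if and only if both of the following hold: (i) $(\mathcal{L}*_L\mathcal{B}^{\dagger}_{\mathcal{N}\mathcal{L}}*_N\mathcal{A}^{\dagger}_{\mathcal{M}\mathcal{N}}*_M\mathcal{A}*_N\mathcal{B})^H=\mathcal{L}*_L\mathcal{B}^{\dagger}_{\mathcal{N}\mathcal{L}}*_N\mathcal{A}^{\dagger}_{\mathcal{M}\mathcal{N}}*_M\mathcal{A}*_N\mathcal{B}$; (ii) $\mathcal{B}*_L\mathcal{B}^{\dagger}_{\mathcal{N}\mathcal{L}}*_N\mathcal{A}^{\#}_{\mathcal{M}\mathcal{N}}*_M\mathcal{A}*_N\mathcal{B}=\mathcal{A}^{\#}_{\mathcal{M}\mathcal{N}}*_M\mathcal{A}*_N\m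athcal{B}$.
   Context: For $\mathcal{A}\in\mathbb{C}^{I_1\times\cdots\times I_M\times J_1\times\cdots\times J_N}$ and $\mathcal{B}\in\mathbb{C}^{J_1\times\cdots\times J_N\times K_1\times\cdots\times K_L}$ the Einstein product $*_N$ (contracting $N$ indices) is $(\mathcal{A}*_N\mathcal{B})_{i_1\cdots i_Mk_1\cdots k_L}=\sum_{j_1,\dots,j_N}a_{i_1\cdots i_Mj_1\cdots j_N}b_{j_1\cdots j_Nk_1\cdots k_L}$; $*_M,*_L,*_K$ are defined likewise. The conjugate transpose is $(\mathcal{A}^H)_{j_1\cdots j_Ni_1\cdots i_M}=\overline{a_{i_1\cdots i_Mj_1\cdots j_N}}$. In $\mathbb{C}^{I_1\times\cdots\times I_K\times I_1\times\cdots\times I_K}$: the identity tensor $\mathcal{I}$ has entries $\prod_k\delta_{i_kj_k}$; $\mathcal{U}$ is unitary if $\mathcal{U}*_K\mathcal{U}^H=\mathcal{U}^H*_K\mathcal{U}=\mathcal{I}$; $\mathcal{D}$ is diagonal if $d_{i_1\cdots i_Kj_1\cdots j_K}=0$ whenever $(i_1,\dots,i_K)\ne(j_1,\dots,j_K)$; $\mathcal{P}$ is Hermitian positive definite if $\mathcal{P}=\mathcal{U}*_K\mathcal{D}*_K\mathcal{U}^H$ with $\mathcal{U}$ unitary and $\mathcal{D}$ diagonal with positive diagonal entries; $\mathcal{P}^{-1}$ is the inverse with respect to $*_K$. For any $\mathcal{A}\in\mathbb{C}^{I_1\times\cdots\times I_M\times J_1\times\cdots\times J_N}$ and Hermitian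 positive definite $\mathcal{S}\in\mathbb{C}^{I_1\times\cdots\times I_M\times I_1\times\cdots\times I_M}$, $\mathcal{T}\in\mathbb{C}^{J_1\times\cdots\times J_N\times J_1\times\cdots\times J_N}$: the weighted conjugate transpose is $\mathcal{A}^{\#}_{\mathcal{S}\mathcal{T}}=\mathcal{T}^{-1}*_N\mathcal{A}^H*_M\mathcal{S}$, and the weighted Moore--Penrose inverse $\mathcal{A}^{\dagger}_{\mathcal{S}\mathcal{T}}$ is the unique $\mathcal{X}\in\mathbb{C}^{J_1\times\cdots\times J_N\times I_1\times\cdots\times I_M}$ satisfying $\mathcal{A}*_N\mathcal{X}*_M\mathcal{A}=\mathcal{A}$, $\mathcal{X}*_M\mathcal{A}*_N\mathcal{X}=\mathcal{X}$, $(\mathcal{S}*_M\mathcal{A}*_N\mathcal{X})^H=\mathcal{S}*_M\mathcal{A}*_N\mathcal{X}$, $(\mathcal{T}*_N\mathcal{X}*_M\mathcal{A})^H=\mathcal{T}*_N\mathcal{X}*_M\mathcal{A}$. *)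

theory Defs
  imports Complex_Main "HOL-Library.FuncSet"
begin

text \<open>
  A complex tensor is a list of mode sizes together with its entries. The entries are indexed by
  multi-indices, i.e. lists of indices counted from 0, and are irrelevant (hence fixed by
  \<^term>\<open>extensional\<close>) outside the admissible range, so that \<open>=\<close> on tensors
  means equal shape and equal entries.
\<close>

definition midx :: "nat list \<Rightarrow> nat list set" where
  "midx ds = {i. list_all2 (<) i ds}"

typedef tensor = "{(ds, f :: nat list \<Rightarrow> complex). f \<in> extensional (midx ds)}"
  by auto

definition dims :: "tensor \<Rightarrow> nat list" where
  "dims A = fst (Rep_tensor A)"

definition entry :: "tensor \<Rightarrow> nat list \<Rightarrow> complex" where
  "entry A = snd (Rep_tensor A)"

definition mk_tensor :: "nat list \<Rightarrow> (nat list \<Rightarrow> complex) \<Rightarrow> tensor" where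
  "mk_tensor ds f = Abs_tensor (ds, restrict f (midx ds))"

definition tensors :: "nat list \<Rightarrow> tensor set" where
  "tensors ds = {A. dims A = ds}"

lemma dims_mk_tensor [simp]: "dims (mk_tensor ds f) = ds"
  by (simp add: dims_def mk_tensor_def Abs_tensor_inverse)

lemma entry_mk_tensor [simp]: "i \<in> midx ds \<Longrightarrow> entry (mk_tensor ds f) i = f i"
  by (simp add: entry_def mk_tensor_def Abs_tensor_inverse)

lemma tensor_eqI:
  assumes "dims A = dims B" and "\<And>i. i \<in> midx (dims A) \<Longrightarrow> entry A i = entry B i"
  shows "A = B"
proof -
  have "entry A \<in> extensional (midx (dims A))" "entry B \<in> extensional (midx (dims B))"
    using Rep_tensor[of A] Rep_tensor[of B] by (auto simp: entry_def dims_def)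
  then have "entry A = entry B"
    using assms by (auto intro: extensionalityI)
  then show ?thesis
    using assms(1) by (metis Rep_tensor_inject dims_def entry_def prod_eqI)
qed

lemma length_midx: "i \<in> midx ds \<Longrightarrow> length i = length ds"
  by (auto simp: midx_def dest: list_all2_lengthD)

lemma append_in_midx: "i \<in> midx ds \<Longrightarrow> j \<in> midx es \<Longrightarrow> i @ j \<in> midx (ds @ es)"
  by (auto simp: midx_def intro: list_all2_appendI)

text \<open>
  The Einstein product contracts the last \<open>N\<close> modes of \<open>A\<close> with the first \<open>N\<close> modes of \<open>B\<close>;
  it is meaningful when their sizes agree.
\<close>

definition einstein :: "tensor \<Rightarrow> nat \<Rightarrow> tensor \<Rightarrow> tensor"
    ("(_ \<star>\<^bsub>_\<^esub>/ _)" [70, 0, 71] 70) where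
  "A \<star>\<^bsub>N\<^esub> B = (let M = length (dims A) - N in
     mk_tensor (take M (dims A) @ drop N (dims B))
       (\<lambda>x. \<Sum>j\<in>midx (take N (dims B)). entry A (take M x @ j) * entry B (j @ drop M x)))"

lemma einstein_tensors:
  assumes "A \<in> tensors (I @ J)" "B \<in> tensors (J @ K)"
  shows "A \<star>\<^bsub>length J\<^esub> B \<in> tensors (I @ K)"
  using assms by (simp add: tensors_def einstein_def Let_def)

lemma entry_einstein:
  assumes "A \<in> tensors (I @ J)" "B \<in> tensors (J @ K)" "i \<in> midx I" "k \<in> midx K"
  shows "entry (A \<star>\<^bsub>length J\<^esub> B) (i @ k) = (\<Sum>j\<in>midx J. entry A (i @ j) * entry B (j @ k))"
  using assms append_in_midx[of i I k K] length_midx[of i I]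
  by (simp add: tensors_def einstein_def Let_def)

text \<open>
  The conjugate transpose depends on where the modes are split: \<open>M\<close> is the number of leading modes
  that are exchanged with the remaining ones.
\<close>

definition ctranspose :: "nat \<Rightarrow> tensor \<Rightarrow> tensor" where
  "ctranspose M A = (let N = length (dims A) - M in
     mk_tensor (drop M (dims A) @ take M (dims A)) (\<lambda>x. cnj (entry A (drop N x @ take N x))))"

lemma ctranspose_tensors:
  assumes "A \<in> tensors (I @ J)"
  shows "ctranspose (length I) A \<in> tensors (J @ I)"
  using assms by (simp add: tensors_def ctranspose_def Let_def)

lemma entry_ctranspose:
  assumes "A \<in> tensors (I @ J)" "i \<in> midx I" "j \<in> midx J"
  shows "entry (ctranspose (length I) A) (j @ i) = cnj (entry A (i @ j))"
  using assms append_in_midx[of j J i I] length_midx[of j J]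
  by (simp add: tensors_def ctranspose_def Let_def)

definition id_tensor :: "nat list \<Rightarrow> tensor" where
  "id_tensor ds = mk_tensor (ds @ ds)
     (\<lambda>x. \<Prod>k<length ds. if x ! k = x ! (length ds + k) then 1 else 0)"

definition unitary_tensor :: "nat list \<Rightarrow> tensor \<Rightarrow> bool" where
  "unitary_tensor ds U \<longleftrightarrow> U \<in> tensors (ds @ ds) \<and>
     U \<star>\<^bsub>length ds\<^esub> ctranspose (length ds) U = id_tensor ds \<and>
     ctranspose (length ds) U \<star>\<^bsub>length ds\<^esub> U = id_tensor ds"

definition diagonal_tensor :: "nat list \<Rightarrow> tensor \<Rightarrow> bool" where
  "diagonal_tensor ds D \<longleftrightarrow> D \<in> tensors (ds @ ds) \<and>
     (\<forall>i\<in>midx ds. \<forall>j\<in>midx ds. i \<noteq> j \<longrightarrow> entry D (i @ j) = 0)"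

definition hpd_tensor :: "nat list \<Rightarrow> tensor \<Rightarrow> bool" where
  "hpd_tensor ds P \<longleftrightarrow> P \<in> tensors (ds @ ds) \<and>
     (\<exists>U D. unitary_tensor ds U \<and> diagonal_tensor ds D \<and>
        (\<forall>i\<in>midx ds. entry D (i @ i) \<in> \<real> \<and> Re (entry D (i @ i)) > 0) \<and>
        P = U \<star>\<^bsub>length ds\<^esub> D \<star>\<^bsub>length ds\<^esub> ctranspose (length ds) U)"

definition tensor_inv :: "nat list \<Rightarrow> tensor \<Rightarrow> tensor" where
  "tensor_inv ds P = (THE X. X \<in> tensors (ds @ ds) \<and>
     P \<star>\<^bsub>length ds\<^esub> X = id_tensor ds \<and> X \<star>\<^bsub>length ds\<^esub> P = id_tensor ds)"

text \<open>
  Below, \<open>A\<close> has shape \<open>I @ J\<close>, and \<open>S\<close> and \<open>T\<close> are the weights on the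
  \<open>I\<close>-side and on the \<open>J\<close>-side.
\<close>

definition weighted_ctranspose ::
    "nat list \<Rightarrow> nat list \<Rightarrow> tensor \<Rightarrow> tensor \<Rightarrow> tensor \<Rightarrow> tensor" where
  "weighted_ctranspose I J S T A =
     tensor_inv J T \<star>\<^bsub>length J\<^esub> ctranspose (length I) A \<star>\<^bsub>length I\<^esub> S"

definition is_weighted_mp ::
    "nat list \<Rightarrow> nat list \<Rightarrow> tensor \<Rightarrow> tensor \<Rightarrow> tensor \<Rightarrow> tensor \<Rightarrow> bool" where
  "is_weighted_mp I J S T A X \<longleftrightarrow> X \<in> tensors (J @ I) \<and>
     A \<star>\<^bsub>length J\<^esub> X \<star>\<^bsub>length I\<^esub> A = A \<and>
     X \<star>\<^bsub>length I\<^esub> A \<star>\<^bsub>length J\<^esub> X = X \<and>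
     ctranspose (length I) (S \<star>\<^bsub>length I\<^esub> A \<star>\<^bsub>length J\<^esub> X) =
       S \<star>\<^bsub>length I\<^esub> A \<star>\<^bsub>length J\<^esub> X \<and>
     ctranspose (length J) (T \<star>\<^bsub>length J\<^esub> X \<star>\<^bsub>length I\<^esub> A) =
       T \<star>\<^bsub>length J\<^esub> X \<star>\<^bsub>length I\<^esub> A"

definition weighted_mp ::
    "nat list \<Rightarrow> nat list \<Rightarrow> tensor \<Rightarrow> tensor \<Rightarrow> tensor \<Rightarrow> tensor" where
  "weighted_mp I J S T A = (THE X. is_weighted_mp I J S T A X)"

end

theory Submission
  imports Defs "HOL-Library.Function_Algebras"
begin

text \<open>
  All tensors embed, compatibly with Einstein products and conjugate transposes, into the ring of
  finitely supported complex matrices indexed by multi-indices. There the product is total and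
  associative, and \<open>star x * x = 0\<close> forces \<open>x = 0\<close>. A Hermitian positive
  definite weight factors as \<open>P = R\<^sup>H R\<close> with \<open>R\<close> invertible, and
  \<open>A \<mapsto> R\<^sub>S A R\<^sub>T\<^sup>-\<^sup>1\<close> turns the weighted Moore--Penrose
  inverse into the unweighted one. The unweighted inverse exists because every matrix \<open>a\<close> satisfies \<open>a * h * a = a\<close> for some
  \<open>h\<close>. So only Greville's argument in a ring with proper involution is
  left: with \<open>p = b * y\<close>, condition (ii) says that \<open>p\<close> commutes with
  \<open>star a * a\<close>, hence with \<open>x * a\<close>; conversely, (ii) follows since a vector fixed
  by a product of two orthogonal projections is fixed by both.
\<close>

section \<open>Moore-Penrose inverses in rings with proper involution\<close>

text \<open>No unit is assumed: over infinitely many multi-indices the identity matrix is not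
  finitely supported. Projections \<open>e\<close> with \<open>e * a = a\<close> act as local units
  instead.\<close>

class proper_star_ring = ring +
  fixes star :: "'a \<Rightarrow> 'a"
  assumes star_star [simp]: "star (star x) = x"
    and star_mult [simp]: "star (x * y) = star y * star x"
    and star_diff [simp]: "star (x - y) = star x - star y"
    and star_mult_self_eq_0_iff: "star x * x = 0 \<longleftrightarrow> x = 0"
begin

definition mp_inverse :: "'a \<Rightarrow> 'a \<Rightarrow> bool" where
  "mp_inverse a x \<longleftrightarrow>
     a * x * a = a \<and> x * a * x = x \<and> star (a * x) = a * x \<and> star (x * a) = x * a"

text \<open>Both \<open>a * x\<close> and \<open>a * y\<close> are self-adjoint and
  \<open>a * y * (a * x) = a * x\<close>; taking adjoints gives \<open>a * x = a * y\<close>.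
  Likewise \<open>x * a = y * a\<close>, so \<open>x = x * a * x = y * a * y = y\<close>.\<close>

lemma mp_inverse_unique:
  assumes x: "mp_inverse a x" and y: "mp_inverse a y"
  shows "x = y"
proof -
  have "a * x = star (a * y * (a * x))"
    using x y unfolding mp_inverse_def by (metis mult_assoc)
  also have "\<dots> = star (a * x) * star (a * y)"
    by (rule star_mult)
  also have "\<dots> = a * y"
    using x y unfolding mp_inverse_def by (metis mult_assoc)
  finally have ax: "a * x = a * y" .
  have "x * a = star (x * a * (y * a))"
    using x y unfolding mp_inverse_def by (metis mult_assoc)
  also have "\<dots> = star (y * a) * star (x * a)"
    by (rule star_mult)
  also have "\<dots> = y * a"
    using x y unfolding mp_inverse_def by (metis mult_assoc)
  finally have xa: "x * a = y * a" .
  show ?thesis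
    using x y ax xa unfolding mp_inverse_def by (metis mult_assoc)
qed

text \<open>The Penrose equations give \<open>x = star a * star x * x = x * star x * star a\<close>,
  so \<open>x\<close> inherits the local units of \<open>star a\<close>. This keeps an inverse found
  in the big ring inside the block of the given shape.\<close>

lemma mp_inverse_absorb:
  assumes x: "mp_inverse a x"
    and "e * a = a" "a * e' = a" "star e = e" "star e' = e'"
  shows "e' * x = x" "x * e = x"
proof -
  have "e' * star a = star a" "star a * e = star a"
    using assms(2-) star_mult[of a e'] star_mult[of e a] by simp_all
  moreover have "x = star a * star x * x" "x = x * star x * star a"
    using x star_mult[of x a] star_mult[of a x] by (simp_all add: mp_inverse_def mult_assoc)
  ultimately show "e' * x = x" "x * e = x"
    by (metis mult_assoc)+
qed

lemma eq_if_star_mult_self_diff_eq_0: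
  assumes "star (x - y) * (x - y) = 0"
  shows "x = y"
  using assms star_mult_self_eq_0_iff[of "x - y"] by simp

text \<open>With \<open>w = a * h * star a * a - a\<close>, the hypothesis makes
  \<open>star w * w\<close> vanish, so \<open>w = 0\<close> by properness. Thus
  \<open>a * h * star a\<close> is the orthogonal projection onto the range of \<open>a\<close>,
  although \<open>h\<close> need not be self-adjoint.\<close>

lemma self_adjoint_projection_from_gram:
  assumes h: "star a * a * h * (star a * a) = star a * a"
  shows "a * h * star a * a = a" "star (a * h * star a) = a * h * star a"
proof -
  let ?w = "a * h * star a * a - a"
  have "star ?w * ?w = star (h * star a * a) * (star a * a * h * (star a * a) - star a * a)
      - (star a * a * h * (star a * a) - star a * a)"
    by (simp add: algebra_simps)
  then show aha: "a * h * star a * a = a"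
    using h eq_if_star_mult_self_diff_eq_0[of "a * h * star a * a" a] by simp
  have "star a * a * star h * star a = star a"
    using arg_cong[OF aha, of star] by (simp add: mult_assoc)
  then have "a * h * star a = a * h * star a * a * star h * star a"
    by (simp add: mult_assoc)
  also have "\<dots> = a * star h * star a"
    using aha by simp
  finally show "star (a * h * star a) = a * h * star a"
    by (simp add: mult_assoc)
qed

text \<open>Urquhart's formula: \<open>l\<close> satisfies the first and third Penrose equations,
  \<open>r\<close> the first and fourth, and \<open>r * a * l\<close> satisfies all four. Regularity
  supplies inner inverses of \<open>star a * a\<close> and \<open>a * star a\<close>.\<close>

lemma ex_mp_inverse:
  assumes regular: "\<And>b. \<exists>h. b * h * b = b"
  shows "\<exists>x. mp_inverse a x"
proof -
  obtain h k where h: "star a * a * h * (star a * a) = star a * a"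
    and k: "a * star a * k * (a * star a) = a * star a"
    using regular by meson
  define l r where "l = h * star a" and "r = star a * k"
  have l: "a * l * a = a" "star (a * l) = a * l"
    using self_adjoint_projection_from_gram[OF h] by (simp_all add: l_def mult_assoc)
  have r_star: "r * a * star a = star a" and ra: "star (r * a) = r * a"
    using self_adjoint_projection_from_gram[of "star a" k] k by (simp_all add: r_def mult_assoc)
  have "a * star (r * a) = a"
    using arg_cong[OF r_star, of star] by (simp del: star_mult add: star_mult[of "r * a"])
  then have r: "a * r * a = a" "star (r * a) = r * a"
    using ra by (simp_all del: star_mult add: mult_assoc)
  have "a * (r * a * l) = a * l" "r * a * l * a = r * a"
    using l(1) r(1) by (simp_all add: mult_assoc[symmetric]) (simp_all add: mult_assoc)
  then have "mp_inverse a (r * a * l)"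
    unfolding mp_inverse_def using l r by (simp del: star_mult) (simp add: mult_assoc)
  then show ?thesis ..
qed

text \<open>The second condition says that the projection \<open>p = b * y\<close> fixes
  \<open>star a * a * b\<close>, which yields the first three Penrose equations for
  \<open>a * b\<close>; the first condition is the fourth.\<close>

lemma reverse_order_law:
  assumes x: "mp_inverse a x" and y: "mp_inverse b y"
  shows "mp_inverse (a * b) (y * x) \<longleftrightarrow>
    star (y * x * a * b) = y * x * a * b \<and> b * y * star a * a * b = star a * a * b"
proof -
  have axa: "a * x * a = a" "x * a * x = x" and byb: "b * y * b = b" "y * b * y = y"
    using x y by (simp_all add: mp_inverse_def)
  have sax: "star x * star a = a * x" "star a * star x = x * a"
    and sby: "star y * star b = b * y" and sxa: "star (x * a) = x * a"
    using x y by (simp_all add: mp_inverse_def)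
  have aax: "star a * a * x = star a"
    using arg_cong[OF axa(1), of star] sax(1) by (simp add: mult_assoc)
  define p where "p = b * y"
  have p: "star p = p" "p * b = b" "y * p = y"
    using sby byb by (simp_all add: p_def mult_assoc)
  define v where "v = star a * a * b"
  show ?thesis
  proof
    assume mp: "mp_inverse (a * b) (y * x)"
    have "star (y * x * a * b) = y * x * a * b"
      using mp by (simp add: mp_inverse_def mult_assoc)
    moreover have "p * v = v"
    proof (rule eq_if_star_mult_self_diff_eq_0)
      have apx: "star (a * p * x) = a * p * x"
        using mp by (simp add: mp_inverse_def mult_assoc p_def)
      have apxab: "a * p * x * a * b = a * b"
        using mp by (simp add: mp_inverse_def mult_assoc p_def)
      \<comment> \<open>Since \<open>a * p * x\<close> is self-adjoint and fixes
        \<open>a * b\<close>, the element \<open>v\<close> is fixed by the product of the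
        projections \<open>x * a\<close> and \<open>p\<close>.\<close>
      have "v = star a * star (a * p * x) * a * b"
        using apxab apx by (simp add: v_def mult_assoc)
      also have "\<dots> = x * a * p * v"
        using sax p(1) by (simp add: v_def mult_assoc[symmetric])
      finally have v: "v = x * a * p * v" .
      \<comment> \<open>As \<open>x * a\<close> also fixes \<open>v\<close>, pairing the previous
        identity with \<open>star v\<close> removes \<open>x * a\<close>: the projection
        \<open>p\<close> does not shorten \<open>v\<close>, which forces
        \<open>p * v = v\<close>.\<close>
      have "star v * x * a = star v"
        using aax arg_cong[OF axa(1), of "\<lambda>t. star b * star a * t"] by (simp add: v_def mult_assoc)
      then have "star v * v = star v * (p * v)"
        using arg_cong[OF v, of "\<lambda>t. star v * t"] by (simp add: mult_assoc[symmetric])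
      moreover have "p * p = p"
        using p(2) by (simp add: p_def mult_assoc[symmetric])
      then have "star v * p * p * v = star v * p * v"
        by (simp add: mult_assoc)
      ultimately show "star (p * v - v) * (p * v - v) = 0"
        using p(1) by (simp add: algebra_simps)
    qed
    ultimately show "star (y * x * a * b) = y * x * a * b
        \<and> b * y * star a * a * b = star a * a * b"
      by (simp add: p_def v_def mult_assoc)
  next
    assume *: "star (y * x * a * b) = y * x * a * b \<and> b * y * star a * a * b = star a * a * b"
    have pv: "p * star a * a * b = star a * a * b"
      using * by (simp add: p_def)
    \<comment> \<open>Multiplying by \<open>y\<close> on the right turns \<open>b\<close> into
      \<open>p\<close>. The left side is self-adjoint, hence so is \<open>star a * a * p\<close>;
      that is, \<open>p\<close> commutes with \<open>star a * a\<close>.\<close>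
    have pgp: "p * star a * a * p = star a * a * p"
      using pv by (simp add: p_def mult_assoc[symmetric])
    have "star (p * star a * a * p) = p * star a * a * p"
      using p(1) by (simp add: mult_assoc)
    then have comm: "p * star a * a = star a * a * p"
      unfolding pgp using p(1) by (simp add: mult_assoc)
    \<comment> \<open>This is self-adjointness of \<open>a * p * x\<close>: by
      \<open>star x * star a * a = a\<close> the element \<open>star a * a\<close> comes to stand
      next to \<open>p\<close>, and commuting carries it to the other side.\<close>
    have apx: "a * p * x = star x * p * star a"
    proof -
      have "a * p * x = star x * (star a * a * p) * x"
        using sax axa by (simp add: mult_assoc[symmetric])
      also have "\<dots> = star x * (p * star a * a) * x"
        by (simp only: comm)
      also have "\<dots> = star x * p * (star a * a * x)"
        by (simp only: mult_assoc)
      also have "\<dots> = star x * p * star a"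
        by (simp only: aax)
      finally show ?thesis .
    qed
    have apxa: "a * p * x * a = a * p"
    proof -
      have "a * p * x * a = star x * (p * star a * a)"
        unfolding apx by (simp only: mult_assoc)
      also have "\<dots> = a * p"
        using sax axa by (simp add: comm mult_assoc[symmetric])
      finally show ?thesis .
    qed
    \<comment> \<open>The projection \<open>q = x * a\<close> satisfies
      \<open>q * p * q = q * p\<close>; self-adjointness of the left side makes \<open>q\<close> and
      \<open>p\<close> commute.\<close>
    have qpq: "x * a * p * (x * a) = x * a * p"
      using apxa by (simp add: mult_assoc)
    have "star (q * p * q) = q * p * q" "star (q * p) = p * q" if "star q = q" for q
      using that p(1) by (simp_all add: mult_assoc)
    from this[OF sxa] have qp: "x * a * p = p * x * a"
      unfolding qpq by (simp only: mult_assoc)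
    have "a * b * (y * x) * (a * b) = a * b"
      using arg_cong[OF apxa, of "\<lambda>t. t * b"] p(2) by (simp add: p_def mult_assoc)
    moreover have "y * x * (a * b) * (y * x) = y * x"
    proof -
      have "y * x * (a * b) * (y * x) = y * (x * a * p) * x"
        by (simp add: p_def mult_assoc)
      also have "\<dots> = y * p * (x * a * x)"
        unfolding qp by (simp add: mult_assoc)
      also have "\<dots> = y * x"
        using p(3) axa(2) by simp
      finally show ?thesis .
    qed
    moreover have "star (a * b * (y * x)) = a * b * (y * x)"
      using apx p(1) by (simp add: p_def mult_assoc)
    moreover have "star (y * x * (a * b)) = y * x * (a * b)"
      using * by (simp add: mult_assoc)
    ultimately show "mp_inverse (a * b) (y * x)"
      by (simp add: mp_inverse_def)
  qed
qed


section \<open>Passing between weighted and unweighted inverses\<close>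

text \<open>
  The identity tensors of the various shapes become projections \<open>e\<close> in one non-unital ring;
  \<open>r\<close> and \<open>s\<close> are mutually inverse in the corner of \<open>e\<close>.
\<close>

definition factor_pair :: "'a \<Rightarrow> 'a \<Rightarrow> 'a \<Rightarrow> bool" where
  "factor_pair e r s \<longleftrightarrow> star e = e \<and> r * s = e \<and> s * r = e \<and>
     e * r = r \<and> r * e = r \<and> e * s = s \<and> s * e = s"

text \<open>These are rewrite rules for right-associated products: the variants with a trailing
  \<open>z\<close> cancel inside a longer product.\<close>

lemma factor_pair_mult:
  assumes "factor_pair e r s"
  shows "r * s = e" "s * r = e" "e * r = r" "r * e = r" "e * s = s" "s * e = s" "star e = e"
    "r * (s * z) = e * z" "s * (r * z) = e * z" "e * (r * z) = r * z" "r * (e * z) = r * z"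
    "e * (s * z) = s * z" "s * (e * z) = s * z"
    "star s * star r = e" "star r * star s = e"
    "star s * (star r * z) = e * z" "star r * (star s * z) = e * z"
    "star r * e = star r" "e * star r = star r" "star s * e = star s" "e * star s = star s"
    "star r * (e * z) = star r * z" "e * (star r * z) = star r * z"
    "star s * (e * z) = star s * z" "e * (star s * z) = star s * z"
proof -
  note f = assms[unfolded factor_pair_def]
  have *: "star s * star r = e" "star r * star s = e" "star r * e = star r" "e * star r = star r"
    "star s * e = star s" "e * star s = star s"
    using f by (metis star_mult)+
  show "r * s = e" "s * r = e" "e * r = r" "r * e = r" "e * s = s" "s * e = s" "star e = e"
    using f by blast+
  show "r * (s * z) = e * z" "s * (r * z) = e * z" "e * (r * z) = r * z" "r * (e * z) = r * z"
    "e * (s * z) = s * z" "s * (e * z) = s * z"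
    using f by (simp_all add: mult_assoc[symmetric])
  show "star s * star r = e" "star r * star s = e"
    "star s * (star r * z) = e * z" "star r * (star s * z) = e * z"
    "star r * e = star r" "e * star r = star r" "star s * e = star s" "e * star s = star s"
    "star r * (e * z) = star r * z" "e * (star r * z) = star r * z"
    "star s * (e * z) = star s * z" "e * (star s * z) = star s * z"
    using * by (simp_all add: mult_assoc[symmetric])
qed

text \<open>Multiplication by \<open>s\<close> on the left and \<open>r'\<close> on the right undoes
  the conjugation, because \<open>y\<close> and \<open>z\<close> lie in the block cut out by
  \<open>e\<close> and \<open>e'\<close>.\<close>

lemma conjugate_eq_iff:
  assumes "factor_pair e r s" "factor_pair e' r' s'"
    and "e * y = y" "y * e' = y" "e * z = z" "z * e' = z"
  shows "r * y * s' = r * z * s' \<longleftrightarrow> y = z"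
proof
  assume "r * y * s' = r * z * s'"
  then have "s * (r * y * s') * r' = s * (r * z * s') * r'"
    by simp
  then show "y = z"
    using assms(3-) by (simp add: mult_assoc factor_pair_mult[OF assms(1)] factor_pair_mult[OF assms(2)])
qed simp

text \<open>Since \<open>star r * (r * z * s) * r = star r * r * z\<close>, the two elements are
  congruent, and congruence preserves self-adjointness. The symmetry condition weighted by
  \<open>star r * r\<close> thus becomes an ordinary one.\<close>

lemma self_adjoint_conjugate_iff:
  assumes f: "factor_pair e r s" and z: "e * z = z" "z * e = z"
  shows "star (r * z * s) = r * z * s \<longleftrightarrow> star (star r * r * z) = star r * r * z"
proof
  note f = factor_pair_mult[OF f]
  have ez: "e * (z * w) = z * w" "z * (e * w) = z * w" for w
    using z by (simp_all add: mult_assoc[symmetric])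
  {
    assume "star (r * z * s) = r * z * s"
    then have "star r * star (r * z * s) * r = star r * (r * z * s) * r"
      by simp
    moreover have "e * star z = star z"
      using arg_cong[OF z(2), of star] f by simp
    then have "e * (star z * w) = star z * w" for w
      by (simp add: mult_assoc[symmetric])
    ultimately show "star (star r * r * z) = star r * r * z"
      using z ez by (simp add: mult_assoc f)
  next
    assume "star (star r * r * z) = star r * r * z"
    then have "star s * star (star r * r * z) * s = star s * (star r * r * z) * s"
      by simp
    then show "star (r * z * s) = r * z * s"
      using z ez by (simp add: mult_assoc f)
  }
qed

text \<open>The inner factors \<open>s' * r'\<close> and \<open>s * r\<close> cancel in every
  product, so each Penrose equation is transported separately. The right side states them for the
  weights \<open>star r * r\<close> and \<open>star r' * r'\<close>.\<close>

lemma mp_inverse_conjugate_iff: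
  assumes f: "factor_pair e r s" and f': "factor_pair e' r' s'"
    and a: "e * a = a" "a * e' = a" and x: "e' * x = x" "x * e = x"
  shows "mp_inverse (r * a * s') (r' * x * s) \<longleftrightarrow>
    a * x * a = a \<and> x * a * x = x \<and>
    star (star r * r * a * x) = star r * r * a * x \<and>
    star (star r' * r' * x * a) = star r' * r' * x * a"
proof -
  note fs = factor_pair_mult[OF f] factor_pair_mult[OF f']
  have e: "e * (a * w) = a * w" "a * (e' * w) = a * w" "e' * (x * w) = x * w" "x * (e * w) = x * w" for w
    using a x by (simp_all add: mult_assoc[symmetric])
  have ax: "r * a * s' * (r' * x * s) = r * (a * x) * s" "r' * x * s * (r * a * s') = r' * (x * a) * s'"
    "r * (a * x) * s * (r * a * s') = r * (a * x * a) * s'"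
    "r' * (x * a) * s' * (r' * x * s) = r' * (x * a * x) * s"
    by (simp_all add: mult_assoc fs e)
  show ?thesis
    unfolding mp_inverse_def ax
    using conjugate_eq_iff[OF f f', of "a * x * a" a] conjugate_eq_iff[OF f' f, of "x * a * x" x]
      self_adjoint_conjugate_iff[OF f, of "a * x"] self_adjoint_conjugate_iff[OF f', of "x * a"]
    by (simp del: star_mult add: mult_assoc a x e)
qed

end

section \<open>The ring of finitely supported matrices\<close>

typedef 'a finmat = "{f :: 'a \<Rightarrow> 'a \<Rightarrow> complex. finite {(i, j). f i j \<noteq> 0}}"
  morphisms mat_entry Abs_finmat
  by (rule exI[of _ "\<lambda>_ _. 0"]) simp

setup_lifting type_definition_finmat

lemma finite_pairs_iff:
  "finite {(i, j). f i j \<noteq> (0 :: complex)} \<longleftrightarrow> (\<exists>U. finite U \<and> (\<forall>i j. f i j \<noteq> 0 \<longrightarrow> i \<in> U \<and> j \<in> U))"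
  for f :: "'a \<Rightarrow> 'a \<Rightarrow> complex"
proof
  assume fin: "finite {(i, j). f i j \<noteq> 0}"
  show "\<exists>U. finite U \<and> (\<forall>i j. f i j \<noteq> 0 \<longrightarrow> i \<in> U \<and> j \<in> U)"
    by (rule exI[of _ "fst ` {(i, j). f i j \<noteq> 0} \<union> snd ` {(i, j). f i j \<noteq> 0}"])
       (use fin in \<open>force\<close>)
next
  assume "\<exists>U. finite U \<and> (\<forall>i j. f i j \<noteq> 0 \<longrightarrow> i \<in> U \<and> j \<in> U)"
  then obtain U where U: "finite U" "\<forall>i j. f i j \<noteq> 0 \<longrightarrow> i \<in> U \<and> j \<in> U"
    by blast
  then have "{(i, j). f i j \<noteq> 0} \<subseteq> U \<times> U"
    by auto
  then show "finite {(i, j). f i j \<noteq> 0}"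
    using U(1) finite_subset by blast
qed

instantiation finmat :: (type) ring
begin

lift_definition zero_finmat :: "'a finmat" is "\<lambda>_ _. 0"
  by simp

lift_definition plus_finmat :: "'a finmat \<Rightarrow> 'a finmat \<Rightarrow> 'a finmat" is "\<lambda>f g i j. f i j + g i j"
  by (rule finite_subset[rotated], erule (1) finite_UnI) auto

lift_definition minus_finmat :: "'a finmat \<Rightarrow> 'a finmat \<Rightarrow> 'a finmat" is "\<lambda>f g i j. f i j - g i j"
  by (rule finite_subset[rotated], erule (1) finite_UnI) auto

lift_definition uminus_finmat :: "'a finmat \<Rightarrow> 'a finmat" is "\<lambda>f i j. - f i j"
  by simp

text \<open>The sum is restricted to the support of row \<open>i\<close> of \<open>f\<close>, since
  a sum over an infinite index set would be 0 by convention.\<close>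

lift_definition times_finmat :: "'a finmat \<Rightarrow> 'a finmat \<Rightarrow> 'a finmat"
  is "\<lambda>f g i k. \<Sum>j | f i j \<noteq> 0. f i j * g j k"
proof -
  fix f g :: "'a \<Rightarrow> 'a \<Rightarrow> complex"
  assume fin: "finite {(i, j). f i j \<noteq> 0}" "finite {(i, j). g i j \<noteq> 0}"
  obtain U where U: "finite U" "\<And>i j. f i j \<noteq> 0 \<Longrightarrow> i \<in> U \<and> j \<in> U"
    using fin(1) unfolding finite_pairs_iff by auto
  obtain V where V: "finite V" "\<And>i j. g i j \<noteq> 0 \<Longrightarrow> i \<in> V \<and> j \<in> V"
    using fin(2) unfolding finite_pairs_iff by auto
  have "i \<in> U \<union> V \<and> k \<in> U \<union> V" if nz: "(\<Sum>j | f i j \<noteq> 0. f i j * g j k) \<noteq> 0" for i k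
  proof -
    obtain j where "f i j * g j k \<noteq> 0"
      using sum.not_neutral_contains_not_neutral[OF nz] by blast
    then show ?thesis
      using U(2) V(2) by auto
  qed
  then show "finite {(i, k). (\<Sum>j | f i j \<noteq> 0. f i j * g j k) \<noteq> 0}"
    unfolding finite_pairs_iff using U(1) V(1) by (intro exI[of _ "U \<union> V"]) simp
qed

lemma finmat_eqI: "(\<And>i j. mat_entry a i j = mat_entry b i j) \<Longrightarrow> a = b"
  by (simp add: mat_entry_inject[symmetric] fun_eq_iff)

definition supported_on :: "'a set \<Rightarrow> 'a finmat \<Rightarrow> bool" where
  "supported_on U a \<longleftrightarrow> finite U \<and> (\<forall>i j. mat_entry a i j \<noteq> 0 \<longrightarrow> i \<in> U \<and> j \<in> U)"

lemma supported_on_exists: "\<exists>U. supported_on U a"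
  using mat_entry[of a] by (simp add: supported_on_def finite_pairs_iff)

lemma supported_on_exists3: "\<exists>U. supported_on U a \<and> supported_on U b \<and> supported_on U c"
proof -
  obtain U V W where *: "supported_on U a" "supported_on V b" "supported_on W c"
    using supported_on_exists by metis
  then show ?thesis
    by (intro exI[of _ "U \<union> V \<union> W"]) (simp add: supported_on_def)
qed

text \<open>Any finite set covering the support of one factor may replace the row-dependent range,
  as all other terms vanish. One \<open>U\<close> then serves all products of a calculation.\<close>

lemma mat_entry_times:
  assumes "supported_on U a \<or> supported_on U b"
  shows "mat_entry (a * b) i k = (\<Sum>j\<in>U. mat_entry a i j * mat_entry b j k)"
proof -
  obtain V where V: "supported_on V a"
    using supported_on_exists by blast
  have "{j. mat_entry a i j \<noteq> 0} \<subseteq> V"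
    using V by (auto simp: supported_on_def)
  then have fin: "finite {j. mat_entry a i j \<noteq> 0}"
    using V by (simp add: supported_on_def finite_subset)
  have "mat_entry (a * b) i k = (\<Sum>j | mat_entry a i j \<noteq> 0. mat_entry a i j * mat_entry b j k)"
    by transfer simp
  also have "\<dots> = (\<Sum>j\<in>U. mat_entry a i j * mat_entry b j k)"
    by (rule sum.mono_neutral_cong) (use assms fin in \<open>auto simp: supported_on_def\<close>)
  finally show ?thesis .
qed

instance
proof
  fix a b c :: "'a finmat"
  show "a + b + c = a + (b + c)" "a + b = b + a" "0 + a = a" "- a + a = 0" "a - b = a + - b"
    by (transfer, simp add: fun_eq_iff algebra_simps)+
  obtain U where U: "supported_on U a" "supported_on U b" "supported_on U c"
    using supported_on_exists3 by blast
  note entry = mat_entry_times[of U]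
  show "a * b * c = a * (b * c)"
  proof (rule finmat_eqI)
    fix i l
    have "mat_entry (a * b * c) i l
        = (\<Sum>k\<in>U. \<Sum>j\<in>U. mat_entry a i j * mat_entry b j k * mat_entry c k l)"
      using U by (simp add: entry sum_distrib_right)
    also have "\<dots> = mat_entry (a * (b * c)) i l"
      using U by (subst sum.swap) (simp add: entry sum_distrib_left mult.assoc)
    finally show "mat_entry (a * b * c) i l = mat_entry (a * (b * c)) i l" .
  qed
  show "(a + b) * c = a * c + b * c"
    by (rule finmat_eqI)
       (use U in \<open>simp add: entry plus_finmat.rep_eq distrib_right sum.distrib\<close>)
  show "a * (b + c) = a * b + a * c"
    by (rule finmat_eqI)
       (use U in \<open>simp add: entry plus_finmat.rep_eq distrib_left sum.distrib\<close>)
qed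

end

instantiation finmat :: (type) proper_star_ring
begin

lift_definition star_finmat :: "'a finmat \<Rightarrow> 'a finmat" is "\<lambda>f i j. cnj (f j i)"
  unfolding finite_pairs_iff by simp blast

instance
proof
  fix a b :: "'a finmat"
  show "star (star a) = a" "star (a - b) = star a - star b"
    by (transfer, simp add: fun_eq_iff)+
  obtain U where U: "supported_on U a" "supported_on U b"
    using supported_on_exists3 by blast
  then have U': "supported_on U (star a)" "supported_on U (star b)"
    by (auto simp: supported_on_def star_finmat.rep_eq)
  show "star (a * b) = star b * star a"
    by (rule finmat_eqI)
       (use U U' in \<open>simp add: star_finmat.rep_eq mat_entry_times[of U] mult.commute\<close>)
  show "star a * a = 0 \<longleftrightarrow> a = 0"
  proof
    assume z: "star a * a = 0"
    have "mat_entry a i k = 0" for i k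
    proof -
      \<comment> \<open>Diagonal entry \<open>k\<close> of \<open>star a * a\<close> is the squared
        norm of column \<open>k\<close> of \<open>a\<close>, so its vanishing kills that
        column.\<close>
      have "(\<Sum>j\<in>U. complex_of_real ((cmod (mat_entry a j k))\<^sup>2)) = mat_entry (star a * a) k k"
        using U by (simp add: mat_entry_times[of U] star_finmat.rep_eq complex_norm_square
            mult.commute del: of_real_power)
      also have "\<dots> = 0"
        by (simp add: z zero_finmat.rep_eq)
      finally have "(\<Sum>j\<in>U. (cmod (mat_entry a j k))\<^sup>2) = 0"
        by (simp only: of_real_sum[symmetric] of_real_eq_0_iff)
      then have "\<forall>j\<in>U. mat_entry a j k = 0"
        using U(1) by (subst (asm) sum_nonneg_eq_0_iff) (auto simp: supported_on_def)
      then show ?thesis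
        using U(1) by (auto simp: supported_on_def)
    qed
    then show "a = 0"
      by (intro finmat_eqI) (simp add: zero_finmat.rep_eq)
  qed (simp add: finmat_eqI zero_finmat.rep_eq)
qed

end

section \<open>Inner inverses of matrices\<close>

interpretation fun_vector_space: vector_space "\<lambda>c v. (\<lambda>i. c * v i) :: 'a \<Rightarrow> complex"
  by unfold_locales (simp_all add: fun_eq_iff algebra_simps)

lemma sum_apply: "(\<Sum>m\<in>A. F m) i = (\<Sum>m\<in>A. F m i :: 'b :: comm_monoid_add)"
  by (induction A rule: infinite_finite_induct) auto

text \<open>Read \<open>a\<close> as a linear map \<open>f\<close> on all functions. It has a linear
  right inverse \<open>g\<close> on its range, and \<open>g\<close> cut down to \<open>U\<close> in
  both indices gives \<open>h\<close>. Nothing is lost, because \<open>f\<close> only reads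
  coordinates in \<open>U\<close> and its values vanish outside \<open>U\<close>.\<close>

lemma finmat_regular: "\<exists>h. a * h * a = a" for a :: "'a finmat"
proof -
  let ?scale = "\<lambda>c v. (\<lambda>i. c * v i) :: 'a \<Rightarrow> complex"
  interpret vector_space_pair ?scale ?scale ..
  obtain U where U: "supported_on U a"
    using supported_on_exists by blast
  then have fin: "finite U"
    by (simp add: supported_on_def)
  define f where "f = (\<lambda>v i. \<Sum>j\<in>U. mat_entry a i j * v j)"
  define d where "d = (\<lambda>k i :: 'a. if i = k then 1 else 0 :: complex)"
  have "Vector_Spaces.linear ?scale ?scale f"
    by (auto simp: linear_iff_module_hom module_hom_iff fun_vector_space.module_axioms
        f_def fun_eq_iff sum.distrib sum_distrib_left algebra_simps)
  then obtain g where g: "Vector_Spaces.linear ?scale ?scale g" "\<And>v. f (g (f v)) = f v"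
    using linear_exists_right_inverse_on[OF _ fun_vector_space.subspace_UNIV, of f] by auto
  interpret g: Vector_Spaces.linear ?scale ?scale g
    by (rule g(1))
  define h where "h = Abs_finmat (\<lambda>j i. if i \<in> U \<and> j \<in> U then g (d i) j else 0)"
  have h: "mat_entry h = (\<lambda>j i. if i \<in> U \<and> j \<in> U then g (d i) j else 0)"
    unfolding h_def
    by (rule Abs_finmat_inverse) (use fin in \<open>auto simp: finite_pairs_iff intro!: exI[of _ U]\<close>)
  then have Uh: "supported_on U h"
    using fin by (simp add: supported_on_def)
  have "mat_entry (a * h * a) i l = mat_entry a i l" for i l
  proof (cases "l \<in> U")
    case True
    \<comment> \<open>Column \<open>l\<close> of \<open>a\<close> is a finite combination of unit
      vectors \<open>d m\<close>, so linearity expresses its image under \<open>g\<close> through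
      the vectors \<open>g (d m)\<close>, whose coordinates in \<open>U\<close> are entries of
      \<open>h\<close>.\<close>
    have fd: "f (d l) = (\<lambda>i. mat_entry a i l)"
      using True fin by (simp add: f_def d_def fun_eq_iff if_distrib[of "(*) _"] cong: if_cong)
    also have "\<dots> = (\<Sum>m\<in>U. ?scale (mat_entry a m l) (d m))"
    proof
      show "mat_entry a i l = (\<Sum>m\<in>U. ?scale (mat_entry a m l) (d m)) i" for i
        using U by (auto simp: sum_apply d_def supported_on_def if_distrib[of "(*) _"] cong: if_cong)
    qed
    finally have "g (f (d l)) = (\<Sum>m\<in>U. ?scale (mat_entry a m l) (g (d m)))"
      by (simp only: g.sum g.scale)
    then have gf: "g (f (d l)) j = (\<Sum>m\<in>U. mat_entry a m l * g (d m) j)" for j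
      by (simp add: sum_apply)
    have f_app: "f v i = (\<Sum>j\<in>U. mat_entry a i j * v j)" for v
      by (simp add: f_def)
    have "mat_entry (a * h * a) i l = f (g (f (d l))) i"
      using U Uh by (simp add: mult.assoc mat_entry_times[of U] gf f_app h mult.commute)
    also have "\<dots> = mat_entry a i l"
      unfolding g(2) by (simp add: fd)
    finally show ?thesis .
  next
    case False
    then have "mat_entry a j l = 0" for j
      using U by (auto simp: supported_on_def)
    then show ?thesis
      using U by (simp add: mat_entry_times[of U])
  qed
  then have "a * h * a = a"
    by (rule finmat_eqI)
  then show ?thesis ..
qed


section \<open>Tensors as matrices\<close>

lemma finite_midx: "finite (midx ds)"
proof (induction ds)
  case (Cons d ds)
  have "midx (d # ds) = (\<lambda>(x, xs). x # xs) ` ({..<d} \<times> midx ds)"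
    by (auto simp: midx_def list_all2_Cons2)
  then show ?case
    using Cons by simp
qed (simp add: midx_def)

lemma midx_appendE:
  assumes "x \<in> midx (I @ J)"
  obtains i j where "x = i @ j" "i \<in> midx I" "j \<in> midx J"
  using assms by (auto simp: midx_def list_all2_append2)

text \<open>
  The shape is not recorded in the matrix, so \<open>tensor_mat I J\<close> is injective only on
  \<open>tensors (I @ J)\<close>.
\<close>

lift_definition tensor_mat :: "nat list \<Rightarrow> nat list \<Rightarrow> tensor \<Rightarrow> nat list finmat"
  is "\<lambda>I J A i j. if i \<in> midx I \<and> j \<in> midx J then entry A (i @ j) else 0"
  subgoal for I J A
    unfolding finite_pairs_iff by (rule exI[of _ "midx I \<union> midx J"]) (simp add: finite_midx)
  done

text \<open>Covers both the local units \<open>unit_mat I\<close> and the square roots of the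
  diagonal factors of the weights.\<close>

lift_definition diag_mat :: "nat list \<Rightarrow> (nat list \<Rightarrow> complex) \<Rightarrow> nat list finmat"
  is "\<lambda>I h i j. if i \<in> midx I \<and> i = j then h i else 0"
  subgoal for I h
    unfolding finite_pairs_iff by (rule exI[of _ "midx I"]) (simp add: finite_midx)
  done

abbreviation unit_mat :: "nat list \<Rightarrow> nat list finmat" where
  "unit_mat I \<equiv> diag_mat I (\<lambda>_. 1)"

lemma supported_on_diag_mat: "supported_on (midx I) (diag_mat I h)"
  by (simp add: supported_on_def finite_midx diag_mat.rep_eq)

lemma mat_entry_diag_mult:
  "mat_entry (diag_mat I h * a) i k = (if i \<in> midx I then h i * mat_entry a i k else 0)"
  by (simp add: mat_entry_times[OF disjI1, OF supported_on_diag_mat] diag_mat.rep_eq finite_midx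
      if_distrib[of "\<lambda>x. x * _"] cong: if_cong)

lemma mat_entry_mult_diag:
  "mat_entry (a * diag_mat I h) i k = (if k \<in> midx I then mat_entry a i k * h k else 0)"
  by (auto simp add: mat_entry_times[OF disjI2, OF supported_on_diag_mat] diag_mat.rep_eq finite_midx
      if_distrib[of "(*) _"] cong: if_cong)

lemma diag_mat_mult: "diag_mat I h * diag_mat I h' = diag_mat I (\<lambda>i. h i * h' i)"
  by (rule finmat_eqI) (auto simp: mat_entry_diag_mult diag_mat.rep_eq)

lemma diag_mat_cong: "(\<And>i. i \<in> midx I \<Longrightarrow> h i = h' i) \<Longrightarrow> diag_mat I h = diag_mat I h'"
  by (rule finmat_eqI) (auto simp: diag_mat.rep_eq)

lemma star_diag_mat: "star (diag_mat I h) = diag_mat I (\<lambda>i. cnj (h i))"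
  by (rule finmat_eqI) (auto simp: star_finmat.rep_eq diag_mat.rep_eq)

lemma unit_mult_tensor_mat [simp]: "unit_mat I * tensor_mat I J A = tensor_mat I J A"
  by (rule finmat_eqI) (simp add: mat_entry_diag_mult tensor_mat.rep_eq)

lemma tensor_mat_mult_unit [simp]: "tensor_mat I J A * unit_mat J = tensor_mat I J A"
  by (rule finmat_eqI) (simp add: mat_entry_mult_diag tensor_mat.rep_eq)

lemma tensor_mat_eq_iff:
  assumes "A \<in> tensors (I @ J)" "B \<in> tensors (I @ J)"
  shows "tensor_mat I J A = tensor_mat I J B \<longleftrightarrow> A = B"
proof
  assume eq: "tensor_mat I J A = tensor_mat I J B"
  show "A = B"
  proof (rule tensor_eqI)
    show "dims A = dims B"
      using assms by (simp add: tensors_def)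
    fix x
    assume "x \<in> midx (dims A)"
    then obtain i j where x: "x = i @ j" "i \<in> midx I" "j \<in> midx J"
      using assms(1) by (auto simp: tensors_def elim: midx_appendE)
    then show "entry A x = entry B x"
      using arg_cong[OF eq, of "\<lambda>a. mat_entry a i j"] by (simp add: tensor_mat.rep_eq)
  qed
qed simp

lemma tensor_mat_einstein:
  assumes "A \<in> tensors (I @ J)" "B \<in> tensors (J @ K)"
  shows "tensor_mat I K (A \<star>\<^bsub>length J\<^esub> B) = tensor_mat I J A * tensor_mat J K B"
proof (rule finmat_eqI)
  let ?U = "midx I \<union> midx J"
  have U: "supported_on ?U (tensor_mat I J A)"
    by (simp add: supported_on_def finite_midx tensor_mat.rep_eq)
  fix i k
  have "mat_entry (tensor_mat I J A * tensor_mat J K B) i k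
      = (\<Sum>j\<in>midx J. mat_entry (tensor_mat I J A) i j * mat_entry (tensor_mat J K B) j k)"
    unfolding mat_entry_times[OF disjI1, OF U]
    by (rule sum.mono_neutral_right) (auto simp: finite_midx tensor_mat.rep_eq)
  then show "mat_entry (tensor_mat I K (A \<star>\<^bsub>length J\<^esub> B)) i k
      = mat_entry (tensor_mat I J A * tensor_mat J K B) i k"
    by (auto simp: tensor_mat.rep_eq entry_einstein[OF assms])
qed

lemma tensor_mat_ctranspose:
  assumes "A \<in> tensors (I @ J)"
  shows "tensor_mat J I (ctranspose (length I) A) = star (tensor_mat I J A)"
  by (rule finmat_eqI)
     (simp add: tensor_mat.rep_eq star_finmat.rep_eq entry_ctranspose[OF assms])

lemma id_tensor_tensors: "id_tensor I \<in> tensors (I @ I)"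
  by (simp add: id_tensor_def tensors_def)

lemma tensor_mat_id: "tensor_mat I I (id_tensor I) = unit_mat I"
proof (rule finmat_eqI)
  fix i j
  have "(\<Prod>k<length I. if (i @ j) ! k = (i @ j) ! (length I + k) then 1 else 0)
      = (if i = j then 1 else 0 :: complex)" if ij: "i \<in> midx I" "j \<in> midx I"
  proof (cases "i = j")
    case False
    then obtain k where "k < length I" "i ! k \<noteq> j ! k"
      using ij nth_equalityI[of i j] by (auto simp: length_midx)
    then show ?thesis
      using False ij by (auto simp: length_midx nth_append intro!: prod_zero)
  qed (use ij in \<open>simp add: length_midx nth_append\<close>)
  then show "mat_entry (tensor_mat I I (id_tensor I)) i j = mat_entry (unit_mat I) i j"
    by (auto simp: tensor_mat.rep_eq diag_mat.rep_eq id_tensor_def append_in_midx)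
qed

text \<open>A matrix fixed by both local units vanishes outside the block, so its entries there form
  a tensor. This brings inverses computed in the ring back to tensors.\<close>

lemma tensor_mat_surj:
  assumes "unit_mat I * a = a" "a * unit_mat J = a"
  obtains A where "A \<in> tensors (I @ J)" "tensor_mat I J A = a"
proof
  let ?A = "mk_tensor (I @ J) (\<lambda>x. mat_entry a (take (length I) x) (drop (length I) x))"
  show "?A \<in> tensors (I @ J)"
    by (simp add: tensors_def)
  have "mat_entry a i j = 0" if "i \<notin> midx I \<or> j \<notin> midx J" for i j
    using that arg_cong[OF assms(1), of "\<lambda>a. mat_entry a i j"]
      arg_cong[OF assms(2), of "\<lambda>a. mat_entry a i j"]
    by (auto simp: mat_entry_diag_mult mat_entry_mult_diag)
  then show "tensor_mat I J ?A = a"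
    by (intro finmat_eqI) (auto simp: tensor_mat.rep_eq append_in_midx length_midx)
qed

section \<open>Weights and weighted Moore-Penrose inverses\<close>

text \<open>In the spectral decomposition let \<open>u\<close> be the unitary part, \<open>f\<close>
  the positive square root of the diagonal part and \<open>g\<close> the inverse of
  \<open>f\<close>. The factors are \<open>r = f * star u\<close> and
  \<open>s = u * g\<close>.\<close>

lemma hpd_tensor_factor:
  assumes "hpd_tensor I P"
  obtains r s where "factor_pair (unit_mat I) r s" "tensor_mat I I P = star r * r"
proof -
  obtain U D where U: "unitary_tensor I U" and D: "diagonal_tensor I D"
    and pos: "\<And>i. i \<in> midx I \<Longrightarrow> entry D (i @ i) \<in> \<real> \<and> Re (entry D (i @ i)) > 0"
    and P: "P = U \<star>\<^bsub>length I\<^esub> D \<star>\<^bsub>length I\<^esub> ctranspose (length I) U"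
    using assms unfolding hpd_tensor_def by blast
  define u where "u = tensor_mat I I U"
  define h where "h = (\<lambda>i. sqrt (Re (entry D (i @ i))))"
  define f g where "f = diag_mat I (\<lambda>i. of_real (h i))" and "g = diag_mat I (\<lambda>i. inverse (of_real (h i)))"
  note [simp] = einstein_tensors ctranspose_tensors tensor_mat_einstein tensor_mat_ctranspose
  have Ut: "U \<in> tensors (I @ I)" "D \<in> tensors (I @ I)"
    using U D by (simp_all add: unitary_tensor_def diagonal_tensor_def)
  have "tensor_mat I I (U \<star>\<^bsub>length I\<^esub> ctranspose (length I) U) = unit_mat I"
    "tensor_mat I I (ctranspose (length I) U \<star>\<^bsub>length I\<^esub> U) = unit_mat I"
    using U by (simp_all only: unitary_tensor_def tensor_mat_id)
  then have uu: "u * star u = unit_mat I" "star u * u = unit_mat I"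
    using Ut by (simp_all add: u_def)
  have u: "unit_mat I * u = u" "u * unit_mat I = u"
    by (simp_all add: u_def)
  have su: "unit_mat I * star u = star u" "star u * unit_mat I = star u"
    using arg_cong[OF u(1), of star] arg_cong[OF u(2), of star] by (simp_all add: star_diag_mat)
  have "tensor_mat I I D = diag_mat I (\<lambda>i. entry D (i @ i))"
    using D by (intro finmat_eqI) (auto simp: diagonal_tensor_def tensor_mat.rep_eq diag_mat.rep_eq)
  also have "\<dots> = f * f"
  proof -
    have "entry D (i @ i) = of_real (h i) * of_real (h i)" if "i \<in> midx I" for i
      using pos[OF that] by (simp add: h_def complex_is_Real_iff complex_eq_iff)
    then show ?thesis
      by (simp add: f_def diag_mat_mult cong: diag_mat_cong)
  qed
  finally have d: "tensor_mat I I D = f * f" .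
  have "h i \<noteq> 0" if "i \<in> midx I" for i
    using pos[OF that] by (simp add: h_def)
  then have fg: "f * g = unit_mat I" "g * f = unit_mat I"
    by (auto simp: f_def g_def diag_mat_mult intro!: diag_mat_cong)
  have f: "star f = f" "unit_mat I * f = f" "f * unit_mat I = f" and g: "unit_mat I * g = g" "g * unit_mat I = g"
    by (simp_all add: f_def g_def star_diag_mat diag_mat_mult)
  have assoc: "u * (star u * z) = unit_mat I * z" "star u * (u * z) = unit_mat I * z"
    "f * (g * z) = unit_mat I * z" "g * (f * z) = unit_mat I * z"
    "unit_mat I * (u * z) = u * z" "unit_mat I * (star u * z) = star u * z"
    "unit_mat I * (f * z) = f * z" "unit_mat I * (g * z) = g * z" for z
    using uu fg u su f g by (simp_all add: mult.assoc[symmetric])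
  have "factor_pair (unit_mat I) (f * star u) (u * g)"
    unfolding factor_pair_def
    by (simp add: mult.assoc assoc uu fg u su f g star_diag_mat)
  moreover have "tensor_mat I I P = star (f * star u) * (f * star u)"
    using Ut by (simp add: P f d mult.assoc flip: u_def)
  ultimately show ?thesis
    by (rule that)
qed

text \<open>\<open>s * star s\<close> inverts \<open>star r * r\<close> on both sides within the
  block. Multiplying an arbitrary inverse by it gives uniqueness, which the definite description in
  \<open>tensor_inv\<close> requires.\<close>

lemma tensor_inv_factor:
  assumes P: "P \<in> tensors (I @ I)" and f: "factor_pair (unit_mat I) r s"
    and Pr: "tensor_mat I I P = star r * r"
  shows "tensor_inv I P \<in> tensors (I @ I)" "tensor_mat I I (tensor_inv I P) = s * star s"
proof -
  note f = factor_pair_mult[OF f]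
  obtain X where X: "X \<in> tensors (I @ I)" "tensor_mat I I X = s * star s"
    by (rule tensor_mat_surj[of I "s * star s" I]) (simp_all add: mult.assoc f)
  have iff: "P \<star>\<^bsub>length I\<^esub> Z = id_tensor I \<and> Z \<star>\<^bsub>length I\<^esub> P = id_tensor I \<longleftrightarrow>
      star r * r * tensor_mat I I Z = unit_mat I \<and> tensor_mat I I Z * (star r * r) = unit_mat I"
    if "Z \<in> tensors (I @ I)" for Z
    using that P by (simp add: tensor_mat_eq_iff[of _ I I, symmetric] einstein_tensors id_tensor_tensors
        tensor_mat_einstein tensor_mat_id Pr)
  have "tensor_inv I P = X"
    unfolding tensor_inv_def
  proof (rule the_equality)
    show "X \<in> tensors (I @ I) \<and> P \<star>\<^bsub>length I\<^esub> X = id_tensor I \<and> X \<star>\<^bsub>length I\<^esub> P = id_tensor I"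
      using X by (simp add: iff mult.assoc f)
    fix Z
    assume Z: "Z \<in> tensors (I @ I) \<and> P \<star>\<^bsub>length I\<^esub> Z = id_tensor I \<and> Z \<star>\<^bsub>length I\<^esub> P = id_tensor I"
    then have "tensor_mat I I Z * (star r * r) = unit_mat I"
      using iff by blast
    then have "tensor_mat I I Z * (star r * r) * (s * star s) = unit_mat I * (s * star s)"
      by (simp only:)
    then have "tensor_mat I I Z = tensor_mat I I X"
      by (simp add: X mult.assoc f)
    then show "Z = X"
      using Z X(1) tensor_mat_eq_iff by blast
  qed
  then show "tensor_inv I P \<in> tensors (I @ I)" "tensor_mat I I (tensor_inv I P) = s * star s"
    using X by simp_all
qed

text \<open>\<open>tensor_mat\<close> is injective on each shape and respects products and adjoints,
  so the tensor equations become those of \<open>mp_inverse_conjugate_iff\<close> with factored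
  weights.\<close>

lemma is_weighted_mp_iff:
  assumes "A \<in> tensors (I @ J)" "X \<in> tensors (J @ I)" "S \<in> tensors (I @ I)" "T \<in> tensors (J @ J)"
    and f: "factor_pair (unit_mat I) r s" "factor_pair (unit_mat J) r' s'"
    and "tensor_mat I I S = star r * r" "tensor_mat J J T = star r' * r'"
  shows "is_weighted_mp I J S T A X \<longleftrightarrow>
    mp_inverse (r * tensor_mat I J A * s') (r' * tensor_mat J I X * s)"
  unfolding is_weighted_mp_def
  using assms
  by (simp add: mp_inverse_conjugate_iff[OF f] tensor_mat_eq_iff[of _ I J, symmetric]
      tensor_mat_eq_iff[of _ J I, symmetric] tensor_mat_eq_iff[of _ I I, symmetric]
      tensor_mat_eq_iff[of _ J J, symmetric] einstein_tensors
      ctranspose_tensors tensor_mat_einstein tensor_mat_ctranspose del: star_mult)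

text \<open>Existence and uniqueness carry over from the unweighted inverse of the conjugated
  matrix, so the definite description denotes the weighted inverse.\<close>

lemma weighted_mp_eq_iff:
  assumes "A \<in> tensors (I @ J)" "hpd_tensor I S" "hpd_tensor J T"
  shows "weighted_mp I J S T A = X \<longleftrightarrow> is_weighted_mp I J S T A X"
proof -
  obtain r s where r: "factor_pair (unit_mat I) r s" "tensor_mat I I S = star r * r"
    using assms(2) by (rule hpd_tensor_factor)
  obtain r' s' where r': "factor_pair (unit_mat J) r' s'" "tensor_mat J J T = star r' * r'"
    using assms(3) by (rule hpd_tensor_factor)
  note f = r(1) r'(1) and r = r(2) r'(2)
  note fs = factor_pair_mult[OF f(1)] factor_pair_mult[OF f(2)]
  have weights: "S \<in> tensors (I @ I)" "T \<in> tensors (J @ J)"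
    using assms by (simp_all add: hpd_tensor_def)
  note iff = is_weighted_mp_iff[OF assms(1) _ weights f r]
  have "\<exists>!X. is_weighted_mp I J S T A X"
  proof (rule ex_ex1I)
    let ?a = "r * tensor_mat I J A * s'"
    obtain x where x: "mp_inverse ?a x"
      using ex_mp_inverse finmat_regular by blast
    \<comment> \<open>\<open>X\<close> undoes the conjugation:
      \<open>r' * tensor_mat J I X * s\<close> equals \<open>x\<close> once \<open>x\<close> is
      known to lie in the right block.\<close>
    obtain X where X: "X \<in> tensors (J @ I)" "tensor_mat J I X = s' * x * r"
      by (rule tensor_mat_surj[of J "s' * x * r" I]) (simp_all add: mult.assoc fs)
    have "unit_mat J * x = x" "x * unit_mat I = x"
      using mp_inverse_absorb[OF x, of "unit_mat I" "unit_mat J"] by (simp_all add: mult.assoc fs)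
    then have "r' * (s' * x * r) * s = x"
      by (simp add: mult.assoc fs)
    then show "\<exists>X. is_weighted_mp I J S T A X"
      using x X iff by (intro exI[of _ X]) simp
  next
    fix X Y
    assume XY: "is_weighted_mp I J S T A X" "is_weighted_mp I J S T A Y"
    then have t: "X \<in> tensors (J @ I)" "Y \<in> tensors (J @ I)"
      by (simp_all add: is_weighted_mp_def)
    then have "r' * tensor_mat J I X * s = r' * tensor_mat J I Y * s"
      using XY iff mp_inverse_unique by blast
    then show "X = Y"
      using t conjugate_eq_iff[OF f(2,1)] by (simp add: tensor_mat_eq_iff)
  qed
  then show ?thesis
    unfolding weighted_mp_def by (metis theI')
qed

section \<open>The reverse order law for tensors\<close>

theorem theorem4p11:
  fixes I J K :: "nat list" and A B M N L :: tensor
  assumes "A \<in> tensors (I @ J)" and "B \<in> tensors (J @ K)"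
    and "hpd_tensor I M" and "hpd_tensor J N" and "hpd_tensor K L"
  shows "weighted_mp I K M L (A \<star>\<^bsub>length J\<^esub> B) =
           weighted_mp J K N L B \<star>\<^bsub>length J\<^esub> weighted_mp I J M N A
    \<longleftrightarrow>
      ctranspose (length K)
        (L \<star>\<^bsub>length K\<^esub> weighted_mp J K N L B \<star>\<^bsub>length J\<^esub> weighted_mp I J M N A
           \<star>\<^bsub>length I\<^esub> A \<star>\<^bsub>length J\<^esub> B) =
        L \<star>\<^bsub>length K\<^esub> weighted_mp J K N L B \<star>\<^bsub>length J\<^esub> weighted_mp I J M N A
           \<star>\<^bsub>length I\<^esub> A \<star>\<^bsub>length J\<^esub> B
      \<and>
      B \<star>\<^bsub>length K\<^esub> weighted_mp J K N L B \<star>\<^bsub>length J\<^esub> weighted_ctranspose I J M N A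
           \<star>\<^bsub>length I\<^esub> A \<star>\<^bsub>length J\<^esub> B =
        weighted_ctranspose I J M N A \<star>\<^bsub>length I\<^esub> A \<star>\<^bsub>length J\<^esub> B"
    (is "?mp \<longleftrightarrow> ?i \<and> ?ii")
proof -
  define X Y where "X = weighted_mp I J M N A" and "Y = weighted_mp J K N L B"
  obtain rI sI where fI: "factor_pair (unit_mat I) rI sI" and rI: "tensor_mat I I M = star rI * rI"
    using assms(3) by (rule hpd_tensor_factor)
  obtain rJ sJ where fJ: "factor_pair (unit_mat J) rJ sJ" and rJ: "tensor_mat J J N = star rJ * rJ"
    using assms(4) by (rule hpd_tensor_factor)
  obtain rK sK where fK: "factor_pair (unit_mat K) rK sK" and rK: "tensor_mat K K L = star rK * rK"
    using assms(5) by (rule hpd_tensor_factor)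
  note fs = factor_pair_mult[OF fI] factor_pair_mult[OF fJ] factor_pair_mult[OF fK]
  note [simp] = einstein_tensors ctranspose_tensors tensor_mat_einstein tensor_mat_ctranspose
  have weights [simp]: "M \<in> tensors (I @ I)" "N \<in> tensors (J @ J)" "L \<in> tensors (K @ K)"
    using assms(3-5) by (simp_all add: hpd_tensor_def)
  note [simp] = assms(1,2)
  note Ninv [simp] = tensor_inv_factor[OF weights(2) fJ rJ]
  have mpX: "is_weighted_mp I J M N A X" and mpY: "is_weighted_mp J K N L B Y"
    using assms by (simp_all add: X_def Y_def flip: weighted_mp_eq_iff)
  then have [simp]: "X \<in> tensors (J @ I)" "Y \<in> tensors (K @ J)"
    by (simp_all add: is_weighted_mp_def)
  define a b x y where "a = tensor_mat I J A" and "b = tensor_mat J K B"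
    and "x = tensor_mat J I X" and "y = tensor_mat K J Y"
  have u [simp]: "unit_mat I * a = a" "a * unit_mat J = a" "unit_mat J * b = b" "b * unit_mat K = b"
    "unit_mat J * x = x" "x * unit_mat I = x" "unit_mat K * y = y" "y * unit_mat J = y"
    by (simp_all add: a_def b_def x_def y_def)
  have [simp]: "unit_mat I * (a * z) = a * z" "a * (unit_mat J * z) = a * z"
    "unit_mat J * (b * z) = b * z" "b * (unit_mat K * z) = b * z"
    "unit_mat J * (x * z) = x * z" "x * (unit_mat I * z) = x * z"
    "unit_mat K * (y * z) = y * z" "y * (unit_mat J * z) = y * z" for z
    by (simp_all add: mult.assoc[symmetric])
  let ?a = "rI * a * sJ" and ?b = "rJ * b * sK" and ?x = "rJ * x * sI" and ?y = "rK * y * sJ"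
  have mp: "mp_inverse ?a ?x" "mp_inverse ?b ?y"
    using mpX mpY is_weighted_mp_iff[OF _ _ _ _ fI fJ rI rJ, of A X]
      is_weighted_mp_iff[OF _ _ _ _ fJ fK rJ rK, of B Y]
    by (simp_all add: a_def b_def x_def y_def)
  \<comment> \<open>By uniqueness, the equation says exactly that the product of \<open>Y\<close>
    and \<open>X\<close> is a weighted inverse of the product of \<open>A\<close> and
    \<open>B\<close>.\<close>
  have "?mp \<longleftrightarrow> is_weighted_mp I K M L (A \<star>\<^bsub>length J\<^esub> B) (Y \<star>\<^bsub>length J\<^esub> X)"
    unfolding X_def Y_def by (rule weighted_mp_eq_iff) (simp_all add: assms(3,5))
  also have "\<dots> \<longleftrightarrow> mp_inverse (rI * (a * b) * sK) (rK * (y * x) * sI)"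
    using is_weighted_mp_iff[OF _ _ _ _ fI fK rI rK, of "A \<star>\<^bsub>length J\<^esub> B" "Y \<star>\<^bsub>length J\<^esub> X"]
    by (simp add: a_def b_def x_def y_def)
  \<comment> \<open>The factors \<open>sJ * rJ\<close> of the middle weight cancel in both
    products.\<close>
  also have "\<dots> \<longleftrightarrow> mp_inverse (?a * ?b) (?y * ?x)"
    by (simp add: mult.assoc fs)
  also have "\<dots> \<longleftrightarrow> star (?y * ?x * ?a * ?b) = ?y * ?x * ?a * ?b
      \<and> ?b * ?y * star ?a * ?a * ?b = star ?a * ?a * ?b"
    using mp by (rule reverse_order_law)
  also have "star (?y * ?x * ?a * ?b) = ?y * ?x * ?a * ?b \<longleftrightarrow> ?i"
  proof -
    \<comment> \<open>The product is \<open>y * x * a * b\<close> conjugated by \<open>rK\<close>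
      and \<open>sK\<close>, so its self-adjointness becomes the symmetry condition weighted by
      \<open>L\<close>.\<close>
    have "?y * ?x * ?a * ?b = rK * (y * x * a * b) * sK"
      by (simp add: mult.assoc fs)
    then have "star (?y * ?x * ?a * ?b) = ?y * ?x * ?a * ?b \<longleftrightarrow>
        star (star rK * rK * (y * x * a * b)) = star rK * rK * (y * x * a * b)"
      using self_adjoint_conjugate_iff[OF fK, of "y * x * a * b"] by (simp only: mult.assoc) simp
    also have "\<dots> \<longleftrightarrow> ?i"
      unfolding X_def[symmetric] Y_def[symmetric]
      by (simp add: tensor_mat_eq_iff[of _ K K, symmetric] rK mult.assoc
          a_def b_def x_def y_def del: star_mult)
    finally show ?thesis .
  qed
  also have "?b * ?y * star ?a * ?a * ?b = star ?a * ?a * ?b \<longleftrightarrow> ?ii"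
  proof -
    have star_unit: "star (unit_mat U) = unit_mat U" for U
      by (simp add: star_diag_mat)
    have "star a * unit_mat I = star a" "unit_mat J * star a = star a"
      using u(1,2) star_unit star_mult by metis+
    then have [simp]: "star a * (unit_mat I * z) = star a * z" "unit_mat J * (star a * z) = star a * z" for z
      by (simp_all add: mult.assoc[symmetric])
    \<comment> \<open>\<open>g\<close> is the matrix of the weighted conjugate transpose of
      \<open>A\<close> times \<open>A\<close> times \<open>B\<close>: \<open>sJ * star sJ\<close>
      stands for the inverse of \<open>N\<close> and \<open>star rI * rI\<close> for
      \<open>M\<close>. Multiplying by \<open>rJ\<close> on the left and \<open>sK\<close> on the
      right gives \<open>star ?a * ?a * ?b\<close>.\<close>
    define g where "g = sJ * star sJ * star a * (star rI * rI) * a * b"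
    have "?b * ?y * star ?a * ?a * ?b = rJ * (b * y * g) * sK" "star ?a * ?a * ?b = rJ * g * sK"
      by (simp_all add: mult.assoc fs g_def)
    then have "?b * ?y * star ?a * ?a * ?b = star ?a * ?a * ?b \<longleftrightarrow> b * y * g = g"
      using conjugate_eq_iff[OF fJ fK, of "b * y * g" g] by (simp add: mult.assoc fs g_def)
    also have "\<dots> \<longleftrightarrow> ?ii"
      unfolding X_def[symmetric] Y_def[symmetric]
      by (simp add: tensor_mat_eq_iff[of _ J K, symmetric] rI mult.assoc weighted_ctranspose_def
          a_def b_def x_def y_def g_def)
    finally show ?thesis .
  qed
  finally show ?thesis .
qed

end
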